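(* Let $k \in \{8, 9\}$, let $\varepsilon = k \bmod 2$, let $n \ge k$ be an integer, and let $\varepsilon^* = (n + 1 + \varepsilon) \bmod 2$. Then $$ar_{\mathcal{P}}(n, P_k) \ge \frac{3n + 3\varepsilon - \varepsilon^* - 3}{2}.$$
   Context: All graphs are finite and simple. $P_k$ is the path on $k$ vertices. For positive integers $a,b$, $a \bmod b$ is the remainder when $a$ is divided by $b$. A plane triangulation is a plane graph in which every face (including the outer face) is bounded by a triangle. For a planar graph $H$ and $n \ge |H|$ (where $|H|$ is the number of vertices of $H$), $\mathcal{T}_n(H)$ is the family of all plane triangulations on $n$ vertices that contain a (not necessarily induced) subgraph isomorphic to $H$. Edge-colorings are arbitrary (not necessarily proper). A subgraph of an edge-colored graph is rainbow if all its edges have different colors. The planar anti-Ramsey number $ar_{\mathcal{P}}(n,H)$ is the maximum number of colors used in an edge-coloring of a plane triangulation $T \in \mathcal{T}_n(H)$ such that $T$ contains no rainbow copy of $H$ (the maximum is over all $T\in\mathcal{T}_n(H)$ and all such colorings of $T$). *)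

theory Defs
  imports "HOL-Analysis.Analysis"
begin

record 'a graph =
  verts :: "'a set"
  edges :: "'a set set"

definition simple_graph :: "('a, 'm) graph_scheme \<Rightarrow> bool" where
  "simple_graph G \<longleftrightarrow> finite (verts G) \<and> edges G \<subseteq> {e. e \<subseteq> verts G \<and> card e = 2}"

text \<open>Not necessarily induced.\<close>
definition subgraph :: "'a graph \<Rightarrow> ('a, 'm) graph_scheme \<Rightarrow> bool" where
  "subgraph S G \<longleftrightarrow> simple_graph S \<and> verts S \<subseteq> verts G \<and> edges S \<subseteq> edges G"

definition isomorphic :: "'a graph \<Rightarrow> 'b graph \<Rightarrow> bool" where
  "isomorphic G H \<longleftrightarrow>
    (\<exists>f. bij_betw f (verts G) (verts H) \<and>
      (\<forall>u\<in>verts G. \<forall>v\<in>verts G. {u, v} \<in> edges G \<longleftrightarrow> {f u, f v} \<in> edges H))"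

definition is_copy :: "'a graph \<Rightarrow> 'b graph \<Rightarrow> ('a, 'm) graph_scheme \<Rightarrow> bool" where
  "is_copy S H G \<longleftrightarrow> subgraph S G \<and> isomorphic S H"

definition path_graph :: "nat \<Rightarrow> nat graph" where
  "path_graph k = \<lparr>verts = {0..<k}, edges = {{i, Suc i} | i. Suc i < k}\<rparr>"

text \<open>
  The plane is the type of complex numbers. The vertices of a plane graph are points of the
  plane; an edge is identified with the set of its two endpoints, and \<open>arc_of e\<close>
  parametrises the arc representing it (its values off the edge set are irrelevant).
\<close>
record drawn_graph = "complex graph" +
  arc_of :: "complex set \<Rightarrow> real \<Rightarrow> complex"

definition plane_graph :: "drawn_graph \<Rightarrow> bool" where
  "plane_graph G \<longleftrightarrow>
    simple_graph G \<and>
    (\<forall>e\<in>edges G. arc (arc_of G e) \<and> {pathstart (arc_of G e), pathfinish (arc_of G e)} = e) \<and>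
    (\<forall>e\<in>edges G. (path_image (arc_of G e) - e) \<inter> verts G = {}) \<and>
    (\<forall>e\<in>edges G. \<forall>f\<in>edges G. e \<noteq> f \<longrightarrow>
       (path_image (arc_of G e) - e) \<inter> path_image (arc_of G f) = {})"

text \<open>The faces, including the unbounded one, are the components of the complement of the drawing.\<close>
definition faces :: "drawn_graph \<Rightarrow> complex set set" where
  "faces G = components (- (verts G \<union> (\<Union>e\<in>edges G. path_image (arc_of G e))))"

definition bounded_by_triangle :: "drawn_graph \<Rightarrow> complex set \<Rightarrow> bool" where
  "bounded_by_triangle G F \<longleftrightarrow>
    (\<exists>a b c. a \<noteq> b \<and> b \<noteq> c \<and> a \<noteq> c \<and>
      {a, b} \<in> edges G \<and> {b, c} \<in> edges G \<and> {a, c} \<in> edges G \<and>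
      frontier F = path_image (arc_of G {a, b}) \<union> path_image (arc_of G {b, c})
                     \<union> path_image (arc_of G {a, c}))"

definition plane_triangulation :: "drawn_graph \<Rightarrow> bool" where
  "plane_triangulation T \<longleftrightarrow> plane_graph T \<and> (\<forall>F\<in>faces T. bounded_by_triangle T F)"

definition triangulations :: "nat \<Rightarrow> 'b graph \<Rightarrow> drawn_graph set" where
  "triangulations n H =
    {T. plane_triangulation T \<and> card (verts T) = n \<and> (\<exists>S. is_copy S H T)}"

definition rainbow :: "('a set \<Rightarrow> nat) \<Rightarrow> 'a graph \<Rightarrow> bool" where
  "rainbow c S \<longleftrightarrow> inj_on c (edges S)"

text \<open>
  A colouring of \<open>T\<close> is a function into \<open>nat\<close>, of which only the values on \<open>edges T\<close> matter.
  The set below is always finite, as its elements are at most \<open>n choose 2\<close>; if it is empty,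
  the maximum is unspecified.
\<close>
definition planar_anti_ramsey :: "nat \<Rightarrow> 'b graph \<Rightarrow> nat" where
  "planar_anti_ramsey n H =
    Max {card (c ` edges T) | T c.
          T \<in> triangulations n H \<and> \<not> (\<exists>S. is_copy S H T \<and> rainbow c S)}"

end

theory Submission imports Defs begin

text \<open>
  The triangulation is the join of an edge \<open>x y\<close> with a path: it has a vertex \<open>x\<close> adjacent to all others,
  and the others carry a Hamiltonian path. Cut that path into consecutive blocks of two vertices
  (for \<open>k = 9\<close> a leftover vertex joins the last block). The edges at \<open>x\<close> and the path edges
  inside blocks get pairwise distinct colours, and all remaining edges share one further colour.
  A rainbow path leaves a block at most once other than through \<open>x\<close>, so besides \<open>x\<close> it meets at most three blocks and
  therefore has at most 7 (resp. 8) vertices. The drawing is straight, with \<open>x = \<i>\<close>,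
  \<open>y = -\<i>\<close> and the path at the points \<open>1, 2, \<dots>\<close> of the real axis.
\<close>

section \<open>Straight-line drawings\<close>

text \<open>An edge is an unordered pair, so \<open>SOME\<close> fixes a direction for its segment.
  Either direction gives the same image and the same set of endpoints.\<close>

definition straight_arc :: "complex set \<Rightarrow> real \<Rightarrow> complex" where
  "straight_arc e = (let u = SOME u. u \<in> e in linepath u (SOME v. v \<in> e - {u}))"

definition straight_drawing :: "complex set \<Rightarrow> complex set set \<Rightarrow> drawn_graph" where
  "straight_drawing V E = \<lparr>verts = V, edges = E, arc_of = straight_arc\<rparr>"

lemma straight_arc_props:
  assumes "card e = 2"
  shows "arc (straight_arc e)"
    and "{pathstart (straight_arc e), pathfinish (straight_arc e)} = e"
    and "path_image (straight_arc e) = convex hull e"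
proof -
  define u where "u = (SOME u. u \<in> e)"
  define v where "v = (SOME v. v \<in> e - {u})"
  obtain a b where ab: "e = {a, b}" "a \<noteq> b"
    using assms by (auto simp: card_2_iff)
  have u: "u \<in> e"
    unfolding u_def by (rule someI[of _ a]) (simp add: ab)
  have "\<exists>v. v \<in> e - {u}"
    using ab by auto
  then have v: "v \<in> e - {u}"
    unfolding v_def by (rule someI_ex)
  have e: "e = {u, v}" and "u \<noteq> v"
    using u v ab by auto
  have "straight_arc e = linepath u v"
    by (simp add: straight_arc_def Let_def u_def v_def)
  with e \<open>u \<noteq> v\<close> show "arc (straight_arc e)"
    "{pathstart (straight_arc e), pathfinish (straight_arc e)} = e"
    "path_image (straight_arc e) = convex hull e"
    by (simp_all add: segment_convex_hull)
qed

text \<open>For segments, planarity reduces to one condition: distinct edges meet only in endpoints.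
  \<open>cross\<close> asks this of \<open>e\<close> alone, since \<open>e\<close> and
  \<open>f\<close> can be exchanged.\<close>

lemma plane_graph_straight_drawing:
  assumes "finite V" and E: "\<And>e. e \<in> E \<Longrightarrow> e \<subseteq> V \<and> card e = 2"
    and V: "V \<subseteq> \<Union>E"
    and cross: "\<And>e f z. e \<in> E \<Longrightarrow> f \<in> E \<Longrightarrow> e \<noteq> f \<Longrightarrow> z \<in> convex hull e \<Longrightarrow> z \<in> convex hull f \<Longrightarrow> z \<in> e"
  shows "plane_graph (straight_drawing V E)"
proof -
  have "card e = 2" if "e \<in> E" for e
    using E that by blast
  note arcs = straight_arc_props[OF this]
  show ?thesis
    unfolding plane_graph_def simple_graph_def straight_drawing_def graph.simps drawn_graph.simps
  proof (intro conjI ballI impI)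
    show "finite V" by fact
    show "E \<subseteq> {e. e \<subseteq> V \<and> card e = 2}"
      using E by blast
  next
    fix e assume e: "e \<in> E"
    show "arc (straight_arc e)" "{pathstart (straight_arc e), pathfinish (straight_arc e)} = e"
      by (rule arcs[OF e])+
    show "(path_image (straight_arc e) - e) \<inter> V = {}"
    proof -
      \<comment> \<open>By \<open>V\<close>, the vertex \<open>v\<close> is an endpoint of some
        edge. If that edge is not \<open>e\<close>, then \<open>v\<close> lies on both segments and
        \<open>cross\<close> puts it in \<open>e\<close>.\<close>
      have "v \<in> e" if "v \<in> V" "v \<in> convex hull e" for v
        using V cross[OF e _ _ that(2)] hull_inc[of v _ convex] that(1) by blast
      then show ?thesis
        unfolding arcs(3)[OF e] by blast
    qed
    fix f assume f: "f \<in> E" "e \<noteq> f"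
    show "(path_image (straight_arc e) - e) \<inter> path_image (straight_arc f) = {}"
      using cross[OF e f] unfolding arcs(3)[OF e] arcs(3)[OF f(1)] by blast
  qed
qed

lemma faces_straight_drawing:
  assumes "\<And>e. e \<in> E \<Longrightarrow> card e = 2" and "V \<subseteq> \<Union>E"
  shows "faces (straight_drawing V E) = components (- (\<Union>e\<in>E. convex hull e))"
proof -
  have "(\<Union>e\<in>E. path_image (straight_arc e)) = (\<Union>e\<in>E. convex hull e)"
    using assms(1) by (simp add: straight_arc_props)
  moreover have "V \<subseteq> (\<Union>e\<in>E. convex hull e)"
  proof
    fix v assume "v \<in> V"
    then obtain e where "e \<in> E" "v \<in> e"
      using assms(2) by blast
    then show "v \<in> (\<Union>e\<in>E. convex hull e)"
      by (auto intro: hull_inc)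
  qed
  ultimately show ?thesis
    by (simp add: faces_def straight_drawing_def Un_absorb1)
qed

section \<open>Boundaries of triangles and components of a disjoint union of open sets\<close>

lemma frontier_interior_convex:
  fixes S :: "'a::euclidean_space set"
  assumes "convex S" "interior S \<noteq> {}"
  shows "frontier (interior S) = frontier S"
  using assms by (simp add: frontier_def convex_closure_interior)

text \<open>An open triangle and the exterior of that triangle have the same frontier, the three
  sides. For the open triangle, \<open>F \<noteq> {}\<close> excludes the degenerate case, where the
  interior is empty.\<close>

lemma bounded_by_triangle_straight_drawing:
  assumes E: "{a, b} \<in> E" "{b, c} \<in> E" "{a, c} \<in> E"
    and card: "\<And>e. e \<in> E \<Longrightarrow> card e = 2"
    and F: "F = interior (convex hull {a, b, c}) \<and> F \<noteq> {} \<or> F = - (convex hull {a, b, c})"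
  shows "bounded_by_triangle (straight_drawing V E) F"
proof -
  have "frontier F = frontier (convex hull {a, b, c})"
    using F by (metis frontier_interior_convex frontier_complement convex_convex_hull)
  also have "\<dots> = closed_segment a b \<union> closed_segment b c \<union> closed_segment a c"
    by (simp add: frontier_of_triangle closed_segment_commute[of c a])
  finally have *: "frontier F = closed_segment a b \<union> closed_segment b c \<union> closed_segment a c" .
  have "a \<noteq> b" "b \<noteq> c" "a \<noteq> c"
    using card[OF E(1)] card[OF E(2)] card[OF E(3)] by auto
  then show ?thesis
    unfolding bounded_by_triangle_def
    using E card[OF E(1)] card[OF E(2)] card[OF E(3)] *
    by (intro exI[of _ a] exI[of _ b] exI[of _ c])
       (simp add: straight_drawing_def straight_arc_props segment_convex_hull)
qed

text \<open>By maximality a component contains the member of \<open>\<C>\<close> that it meets; the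
  other members form an open set, so connectedness keeps the component away from them. This is how
  the faces are identified.\<close>

lemma component_of_open_partition:
  assumes F: "F \<in> components S" and S: "S = \<Union>\<C>"
    and op: "\<And>C. C \<in> \<C> \<Longrightarrow> open C" and conn: "\<And>C. C \<in> \<C> \<Longrightarrow> connected C"
    and disj: "\<And>C D. C \<in> \<C> \<Longrightarrow> D \<in> \<C> \<Longrightarrow> C \<noteq> D \<Longrightarrow> C \<inter> D = {}"
  shows "F \<in> \<C>"
proof -
  obtain x where x: "x \<in> F"
    using in_components_nonempty[OF F] by blast
  have FS: "F \<subseteq> S"
    using F by (rule in_components_subset)
  then obtain C where C: "C \<in> \<C>" "x \<in> C"
    using x S by blast
  have CF: "C \<subseteq> F"
    using components_maximal[OF F conn[OF C(1)]] x C S by blast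
  have "open (\<Union>(\<C> - {C}))"
    using op by blast
  moreover have "C \<inter> \<Union>(\<C> - {C}) = {}"
    using disj C(1) by blast
  moreover have "F \<subseteq> C \<union> \<Union>(\<C> - {C})"
    using FS S by blast
  ultimately have "F \<inter> \<Union>(\<C> - {C}) = {}"
    using in_components_connected[OF F] op[OF C(1)] x C(2)
    unfolding connected_def by blast
  then have "F = C"
    using CF \<open>F \<subseteq> C \<union> \<Union>(\<C> - {C})\<close> by blast
  with C show ?thesis by simp
qed

section \<open>Coordinates\<close>

text \<open>With \<open>s\<close> equal to 1 or -1, \<open>s * Im z\<close> is the weight of the
  apex in the convex combination, so one formula serves both apexes.\<close>

lemma mem_segment_apex:
  assumes "s * s = 1"
  shows "z \<in> convex hull {Complex 0 s, Complex r 0} \<longleftrightarrow>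
    0 \<le> s * Im z \<and> s * Im z \<le> 1 \<and> Re z = r * (1 - s * Im z)" (is "_ \<longleftrightarrow> ?R")
proof
  assume "z \<in> convex hull {Complex 0 s, Complex r 0}"
  then obtain u v where uv: "0 \<le> u" "0 \<le> v" "u + v = 1"
    and z: "z = u *\<^sub>R Complex 0 s + v *\<^sub>R Complex r 0"
    by (auto simp: convex_hull_2)
  have "s * Im z = u" using assms z by (simp add: algebra_simps)
  moreover have "Re z = r * v" using z by simp
  moreover have "v = 1 - u" using uv by simp
  ultimately show ?R using uv by simp
next
  assume R: ?R
  have "Im z = s * Im z * s" using assms by (simp add: algebra_simps)
  then have "z = (s * Im z) *\<^sub>R Complex 0 s + (1 - s * Im z) *\<^sub>R Complex r 0"
    using R by (simp add: complex_eq_iff algebra_simps)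
  with R show "z \<in> convex hull {Complex 0 s, Complex r 0}"
    unfolding convex_hull_2 by (intro CollectI exI[of _ "s * Im z"] exI[of _ "1 - s * Im z"]) auto
qed

lemma mem_segment_axis:
  assumes "p < q"
  shows "z \<in> convex hull {Complex p 0, Complex q 0} \<longleftrightarrow> Im z = 0 \<and> p \<le> Re z \<and> Re z \<le> q"
proof -
  have "Complex t 0 = complex_of_real t" for t
    by (simp add: complex_of_real_def)
  then have "convex hull {Complex p 0, Complex q 0} = of_real ` closed_segment p q"
    by (simp add: segment_convex_hull[symmetric] closed_segment_of_real)
  with assms show ?thesis
    by (auto simp: closed_segment_eq_real_ivl image_iff complex_eq_iff intro!: bexI[of _ "Re z"])
qed

lemma mem_segment_apexes:
  "z \<in> convex hull {Complex 0 1, Complex 0 (-1)} \<longleftrightarrow> Re z = 0 \<and> \<bar>Im z\<bar> \<le> 1"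
proof
  assume "z \<in> convex hull {Complex 0 1, Complex 0 (-1)}"
  then show "Re z = 0 \<and> \<bar>Im z\<bar> \<le> 1"
    by (auto simp: convex_hull_2)
next
  assume R: "Re z = 0 \<and> \<bar>Im z\<bar> \<le> 1"
  then have "z = ((1 + Im z)/2) *\<^sub>R Complex 0 1 + ((1 - Im z)/2) *\<^sub>R Complex 0 (-1)"
    by (simp add: complex_eq_iff field_simps)
  moreover have "(1 + Im z)/2 \<ge> 0" "(1 - Im z)/2 \<ge> 0" "(1 + Im z)/2 + (1 - Im z)/2 = 1"
    using R by (auto simp: field_simps)
  ultimately show "z \<in> convex hull {Complex 0 1, Complex 0 (-1)}"
    unfolding convex_hull_2 by blast
qed

text \<open>The horizontal line at distance \<open>s * Im z\<close> from the base cuts the triangle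
  in the base scaled by \<open>1 - s * Im z\<close>. The two bounds on \<open>Re z\<close> differ by
  this factor, which forces it to be nonnegative.\<close>

lemma mem_triangle_axis:
  assumes "s * s = 1"
  shows "z \<in> convex hull {Complex 0 s, Complex r 0, Complex (r + 1) 0} \<longleftrightarrow>
    0 \<le> s * Im z \<and> r * (1 - s * Im z) \<le> Re z \<and> Re z \<le> (r + 1) * (1 - s * Im z)" (is "_ \<longleftrightarrow> ?R")
proof
  assume "z \<in> convex hull {Complex 0 s, Complex r 0, Complex (r + 1) 0}"
  then obtain u v w where uv: "0 \<le> u" "0 \<le> v" "0 \<le> w" "u + v + w = 1"
    and z: "z = u *\<^sub>R Complex 0 s + v *\<^sub>R Complex r 0 + w *\<^sub>R Complex (r + 1) 0"
    by (auto simp: convex_hull_3)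
  have "s * Im z = u" using assms z by (simp add: algebra_simps)
  moreover have "Re z = r * (v + w) + w" using z by (simp add: algebra_simps)
  moreover have "v + w = 1 - u" using uv by simp
  ultimately show ?R using uv by (simp add: algebra_simps)
next
  assume R: ?R
  define u where "u = s * Im z"
  define w where "w = Re z - r * (1 - u)"
  have "Im z = s * Im z * s" using assms by (simp add: algebra_simps)
  then have "z = u *\<^sub>R Complex 0 s + (1 - u - w) *\<^sub>R Complex r 0 + w *\<^sub>R Complex (r + 1) 0"
    by (simp add: complex_eq_iff u_def w_def algebra_simps)
  moreover have "0 \<le> u" "0 \<le> w" "0 \<le> 1 - u - w" "u + (1 - u - w) + w = 1"
    using R by (auto simp: u_def w_def algebra_simps)
  ultimately show "z \<in> convex hull {Complex 0 s, Complex r 0, Complex (r + 1) 0}"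
    unfolding convex_hull_3 by blast
qed

lemma mem_triangle_apexes:
  assumes "r > 0"
  shows "z \<in> convex hull {Complex 0 1, Complex 0 (-1), Complex r 0} \<longleftrightarrow>
    0 \<le> Re z \<and> Re z \<le> r * (1 - \<bar>Im z\<bar>)" (is "_ \<longleftrightarrow> ?R")
proof
  assume "z \<in> convex hull {Complex 0 1, Complex 0 (-1), Complex r 0}"
  then obtain u v w where uv: "0 \<le> u" "0 \<le> v" "0 \<le> w" "u + v + w = 1"
    and z: "z = u *\<^sub>R Complex 0 1 + v *\<^sub>R Complex 0 (-1) + w *\<^sub>R Complex r 0"
    by (auto simp: convex_hull_3)
  have "w \<le> 1 - \<bar>Im z\<bar>" and "Re z = r * w" using uv z by auto
  with assms uv show ?R by simp
next
  assume R: ?R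
  \<comment> \<open>Weight of the corner \<open>Complex r 0\<close>; the remaining weight
    \<open>1 - w\<close> is split between the apexes so that the imaginary part comes out
    right.\<close>
  define w where "w = Re z / r"
  have w: "0 \<le> w" "w \<le> 1 - \<bar>Im z\<bar>"
    using R assms by (auto simp: w_def field_simps)
  have "z = ((1 - w + Im z)/2) *\<^sub>R Complex 0 1 + ((1 - w - Im z)/2) *\<^sub>R Complex 0 (-1) + w *\<^sub>R Complex r 0"
    using assms by (simp add: complex_eq_iff w_def field_simps)
  moreover have "(1 - w + Im z)/2 \<ge> 0" "(1 - w - Im z)/2 \<ge> 0"
    "(1 - w + Im z)/2 + (1 - w - Im z)/2 + w = 1"
    using w by (auto simp: field_simps)
  ultimately show "z \<in> convex hull {Complex 0 1, Complex 0 (-1), Complex r 0}"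
    using w(1) unfolding convex_hull_3 by blast
qed

lemma mem_interior_triangle_axis:
  assumes s: "s * s = 1"
  shows "z \<in> interior (convex hull {Complex 0 s, Complex r 0, Complex (r + 1) 0}) \<longleftrightarrow>
    0 < s * Im z \<and> r * (1 - s * Im z) < Re z \<and> Re z < (r + 1) * (1 - s * Im z)"
proof -
  have "z \<in> interior (convex hull {Complex 0 s, Complex r 0, Complex (r + 1) 0}) \<longleftrightarrow>
    (0 \<le> s * Im z \<and> r * (1 - s * Im z) \<le> Re z \<and> Re z \<le> (r + 1) * (1 - s * Im z)) \<and>
    \<not> (0 \<le> s * Im z \<and> s * Im z \<le> 1 \<and> Re z = r * (1 - s * Im z)) \<and>
    \<not> (Im z = 0 \<and> r \<le> Re z \<and> Re z \<le> r + 1) \<and>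
    \<not> (0 \<le> s * Im z \<and> s * Im z \<le> 1 \<and> Re z = (r + 1) * (1 - s * Im z))"
    using mem_triangle_axis[OF s, of z r] mem_segment_apex[OF s, of z r]
      mem_segment_apex[OF s, of z "r + 1"] mem_segment_axis[of r "r + 1" z]
    by (simp add: interior_of_triangle segment_convex_hull
          insert_commute[of "Complex (r + 1) 0" "Complex 0 s"])
  \<comment> \<open>The interior is the triangle minus its three sides. The identities that follow
    leave a linear problem in \<open>r\<close>, \<open>Re z\<close>, \<open>s * Im z\<close> and
    \<open>r * (1 - s * Im z)\<close>.\<close>
  moreover have "Im z = 0 \<longleftrightarrow> s * Im z = 0"
    using s by auto
  moreover have "(r + 1) * (1 - s * Im z) = r * (1 - s * Im z) + (1 - s * Im z)"
    by (simp add: algebra_simps)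
  moreover have "r * (1 - s * Im z) = r" if "s * Im z = 0"
    using that by simp
  ultimately show ?thesis
    by (smt (verit))
qed

lemma mem_interior_triangle_apexes:
  assumes "r > 0"
  shows "z \<in> interior (convex hull {Complex 0 1, Complex 0 (-1), Complex r 0}) \<longleftrightarrow>
    0 < Re z \<and> Re z < r * (1 - \<bar>Im z\<bar>)"
proof -
  have "z \<in> interior (convex hull {Complex 0 1, Complex 0 (-1), Complex r 0}) \<longleftrightarrow>
    (0 \<le> Re z \<and> Re z \<le> r * (1 - \<bar>Im z\<bar>)) \<and>
    \<not> (Re z = 0 \<and> \<bar>Im z\<bar> \<le> 1) \<and>
    \<not> (0 \<le> - Im z \<and> - Im z \<le> 1 \<and> Re z = r * (1 + Im z)) \<and>
    \<not> (0 \<le> Im z \<and> Im z \<le> 1 \<and> Re z = r * (1 - Im z))"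
    using mem_triangle_apexes[OF assms, of z] mem_segment_apexes[of z]
      mem_segment_apex[of 1 z r] mem_segment_apex[of "-1" z r]
    by (simp add: interior_of_triangle segment_convex_hull
          insert_commute[of "Complex r 0" "Complex 0 1"])
  also have "\<dots> \<longleftrightarrow> 0 < Re z \<and> Re z < r * (1 - \<bar>Im z\<bar>)"
  proof -
    have "\<bar>Im z\<bar> \<le> 1" if "0 \<le> r * (1 - \<bar>Im z\<bar>)"
      using that assms by (simp add: zero_le_mult_iff)
    then show ?thesis
      by (cases "Im z \<ge> 0") auto
  qed
  finally show ?thesis .
qed

section \<open>The double fan\<close>

definition fan_vertices :: "nat \<Rightarrow> complex set" where
  "fan_vertices m = {Complex 0 1, Complex 0 (-1)} \<union> (\<lambda>r. Complex (real r) 0) ` {1..m}"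

definition fan_edges :: "nat \<Rightarrow> complex set set" where
  "fan_edges m = {{Complex 0 1, Complex 0 (-1)}}
     \<union> {{Complex 0 s, Complex (real r) 0} | s r. s \<in> {1, -1} \<and> 1 \<le> r \<and> r \<le> m}
     \<union> {{Complex (real r) 0, Complex (real r + 1) 0} | r. 1 \<le> r \<and> r < m}"

text \<open>\<open>fan_faces_disjoint\<close> and \<open>fan_faces_Union\<close> show that these are
  the faces. For \<open>m \<ge> 1\<close> they number \<open>2 * m\<close>, as Euler's formula
  requires of a triangulation on \<open>m + 2\<close> vertices.\<close>

definition fan_faces :: "nat \<Rightarrow> complex set set" where
  "fan_faces m =
     {interior (convex hull {Complex 0 1, Complex 0 (-1), Complex 1 0}),
      - (convex hull {Complex 0 1, Complex 0 (-1), Complex (real m) 0})}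
     \<union> {interior (convex hull {Complex 0 s, Complex (real r) 0, Complex (real r + 1) 0}) | s r.
          s \<in> {1, -1} \<and> 1 \<le> r \<and> r < m}"

lemma fan_edges_cases [consumes 1, case_names apexes spoke axis]:
  assumes "e \<in> fan_edges m"
  obtains "e = {Complex 0 1, Complex 0 (-1)}"
  | s r where "e = {Complex 0 s, Complex (real r) 0}" "s = 1 \<or> s = -1" "1 \<le> r" "r \<le> m"
  | r where "e = {Complex (real r) 0, Complex (real r + 1) 0}" "1 \<le> r" "r < m"
  using assms unfolding fan_edges_def by blast

lemma mem_fan_edge_cases [consumes 2, case_names apexes spoke axis]:
  assumes "e \<in> fan_edges m" "z \<in> convex hull e"
  obtains "e = {Complex 0 1, Complex 0 (-1)}" "Re z = 0" "\<bar>Im z\<bar> \<le> 1"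
  | s r where "e = {Complex 0 s, Complex (real r) 0}" "s = 1 \<or> s = -1" "1 \<le> r" "r \<le> m"
      "0 \<le> s * Im z" "s * Im z \<le> 1" "Re z = real r * (1 - s * Im z)"
  | r where "e = {Complex (real r) 0, Complex (real r + 1) 0}" "1 \<le> r" "r < m"
      "Im z = 0" "real r \<le> Re z" "Re z \<le> real r + 1"
  using assms(1)
proof (cases rule: fan_edges_cases)
  case apexes
  with assms(2) that(1) show ?thesis by (simp add: mem_segment_apexes)
next
  case (spoke s r)
  then have "s * s = 1" by auto
  have "0 \<le> s * Im z \<and> s * Im z \<le> 1 \<and> Re z = real r * (1 - s * Im z)"
    using assms(2) unfolding spoke(1) mem_segment_apex[OF \<open>s * s = 1\<close>] .
  with spoke that(2)[of s r] show ?thesis by blast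
next
  case (axis r)
  with assms(2) that(3)[of r] show ?thesis by (simp add: mem_segment_axis)
qed

lemma fan_edges_cross:
  assumes "e \<in> fan_edges m" "f \<in> fan_edges m" "e \<noteq> f" "z \<in> convex hull e" "z \<in> convex hull f"
  shows "z \<in> e"
  using assms(1,4)
proof (cases rule: mem_fan_edge_cases)
  case e: apexes
  from assms(2,5) show ?thesis
    using assms(3) e by (cases rule: mem_fan_edge_cases) (auto simp: complex_eq_iff)
next
  case e: (spoke s r)
  from assms(2,5) show ?thesis
  proof (cases rule: mem_fan_edge_cases)
    case apexes
    with e show ?thesis by (auto simp: complex_eq_iff)
  next
    case f: (spoke s' r')
    show ?thesis
    proof (cases "s = s'")
      case True
      \<comment> \<open>Two spokes from the same apex: the equation for \<open>Re z\<close> with two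
        different factors forces \<open>1 - s * Im z = 0\<close>, so \<open>z\<close> is the
        apex.\<close>
      then have "r \<noteq> r'" "real r * (1 - s * Im z) = real r' * (1 - s * Im z)"
        using e f assms(3) by auto
      then have "s * Im z = 1" by simp
      with e show ?thesis by (auto simp: complex_eq_iff)
    next
      case False
      \<comment> \<open>Spokes from different apexes lie on opposite sides of the axis.\<close>
      then have "Im z = 0" using e f by auto
      with e show ?thesis by (simp add: complex_eq_iff)
    qed
  next
    case axis
    with e show ?thesis by (simp add: complex_eq_iff)
  qed
next
  case e: (axis r)
  from assms(2,5) show ?thesis
  proof (cases rule: mem_fan_edge_cases)
    case apexes
    with e show ?thesis by simp
  next
    case (spoke s' r')
    then have "Re z = real r'" using e by simp
    \<comment> \<open>A spoke reaches the axis only at its integer foot \<open>r'\<close>, which can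
      only be an end of the unit interval.\<close>
    moreover from this have "r' = r \<or> r' = Suc r" using e(5,6) by linarith
    ultimately show ?thesis using e by (auto simp: complex_eq_iff)
  next
    case (axis r')
    then have "r \<noteq> r'" using e assms(3) by auto
    then have "Re z = real r \<or> Re z = real r + 1"
      using e(5,6) axis(5,6) by linarith
    then show ?thesis using e by (auto simp: complex_eq_iff)
  qed
qed

lemma card_fan_edge:
  assumes "e \<in> fan_edges m"
  shows "card e = 2"
  using assms by (cases rule: fan_edges_cases) auto

lemma fan_edge_subset:
  assumes "e \<in> fan_edges m"
  shows "e \<subseteq> fan_vertices m"
  using assms
proof (cases rule: fan_edges_cases)
  case (axis r)
  then have "Complex (real r + 1) 0 \<in> (\<lambda>r. Complex (real r) 0) ` {1..m}"
    by (intro image_eqI[of _ _ "Suc r"]) auto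
  with axis show ?thesis by (auto simp: fan_vertices_def)
qed (auto simp: fan_vertices_def)

lemma fan_vertices_covered: "fan_vertices m \<subseteq> \<Union>(fan_edges m)"
proof
  fix v assume "v \<in> fan_vertices m"
  then consider "v \<in> {Complex 0 1, Complex 0 (-1)}"
    | r where "v \<in> {Complex 0 1, Complex (real r) 0}" "1 \<le> r" "r \<le> m"
    unfolding fan_vertices_def by auto
  then show "v \<in> \<Union>(fan_edges m)"
  proof cases
    case 1
    moreover have "{Complex 0 1, Complex 0 (-1)} \<in> fan_edges m"
      by (simp add: fan_edges_def)
    ultimately show ?thesis by (rule UnionI[rotated])
  next
    case (2 r)
    moreover have "{Complex 0 1, Complex (real r) 0} \<in> fan_edges m"
      using 2 by (auto simp: fan_edges_def)
    ultimately show ?thesis by (intro UnionI)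
  qed
qed

lemma apexes_fan_edge: "{Complex 0 1, Complex 0 (-1)} \<in> fan_edges m"
  by (simp add: fan_edges_def)

lemma spoke_fan_edge:
  assumes "s = 1 \<or> s = -1" "1 \<le> r" "r \<le> m"
  shows "{Complex 0 s, Complex (real r) 0} \<in> fan_edges m"
  using assms unfolding fan_edges_def by auto

lemma axis_fan_edge:
  assumes "1 \<le> r" "r < m"
  shows "{Complex (real r) 0, Complex (real r + 1) 0} \<in> fan_edges m"
  using assms unfolding fan_edges_def by auto

section \<open>Faces of the double fan\<close>

lemma fan_faces_cases [consumes 3, case_names inner outer spoke]:
  assumes "C \<in> fan_faces m" "z \<in> C" "m \<ge> 1"
  obtains "C = interior (convex hull {Complex 0 1, Complex 0 (-1), Complex 1 0})"
      "0 < Re z" "Re z < 1 - \<bar>Im z\<bar>"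
  | "C = - (convex hull {Complex 0 1, Complex 0 (-1), Complex (real m) 0})"
      "\<not> (0 \<le> Re z \<and> Re z \<le> real m * (1 - \<bar>Im z\<bar>))"
  | s r where
      "C = interior (convex hull {Complex 0 s, Complex (real r) 0, Complex (real r + 1) 0})"
      "s = 1 \<or> s = -1" "1 \<le> r" "r < m"
      "0 < s * Im z" "real r * (1 - s * Im z) < Re z" "Re z < (real r + 1) * (1 - s * Im z)"
proof -
  from assms(1) consider
      "C = interior (convex hull {Complex 0 1, Complex 0 (-1), Complex 1 0})"
    | "C = - (convex hull {Complex 0 1, Complex 0 (-1), Complex (real m) 0})"
    | s r where "C = interior (convex hull {Complex 0 s, Complex (real r) 0, Complex (real r + 1) 0})"
        "s = 1 \<or> s = -1" "1 \<le> r" "r < m"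
    unfolding fan_faces_def by blast
  then show ?thesis
  proof cases
    case 1
    with assms(2) that(1) show ?thesis by (simp add: mem_interior_triangle_apexes)
  next
    case 2
    with assms(2,3) that(2) show ?thesis by (simp add: mem_triangle_apexes)
  next
    case (3 s r)
    then have "s * s = 1" by auto
    have "0 < s * Im z \<and> real r * (1 - s * Im z) < Re z \<and> Re z < (real r + 1) * (1 - s * Im z)"
      using assms(2) unfolding 3(1) mem_interior_triangle_axis[OF \<open>s * s = 1\<close>] .
    with 3 that(3)[of s r] show ?thesis by blast
  qed
qed

text \<open>The two bounds on \<open>x\<close> leave room only if \<open>1 - s * y\<close> is
  positive. Since \<open>r\<close> is at least 1, the point then lies beyond the triangle spanned by
  the apexes and the first axis point.\<close>

lemma fan_sector_bounds:
  fixes s y x :: real and r :: nat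
  assumes "s = 1 \<or> s = -1" "0 < s * y" "real r * (1 - s * y) < x" "x < (real r + 1) * (1 - s * y)" "1 \<le> r"
  shows "s * y = \<bar>y\<bar>" "\<bar>y\<bar> < 1" "1 - \<bar>y\<bar> < x" "0 < x"
proof -
  show 1: "s * y = \<bar>y\<bar>" using assms(1,2) by auto
  have "real r * (1 - s * y) < (real r + 1) * (1 - s * y)" using assms(3,4) by linarith
  then show 2: "\<bar>y\<bar> < 1" using 1 by (simp add: algebra_simps)
  have "1 * (1 - \<bar>y\<bar>) \<le> real r * (1 - \<bar>y\<bar>)" using 2 assms(5) by (intro mult_right_mono) auto
  then show "1 - \<bar>y\<bar> < x" using 1 assms(3) by simp
  with 2 show "0 < x" by simp
qed

lemma fan_faces_disjoint:
  assumes C: "C \<in> fan_faces m" and D: "D \<in> fan_faces m" and "C \<noteq> D" and m: "m \<ge> 1"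
  shows "C \<inter> D = {}"
proof -
  have False if z: "z \<in> C" "z \<in> D" for z
  proof -
    \<comment> \<open>For \<open>h > 0\<close>, the quotient \<open>Re z / h\<close> is where the
      line through \<open>z\<close> from the apex on its side meets the axis. For positive
      \<open>Re z\<close>, its position relative to 1, to \<open>m\<close> and to the integers
      between them, together with the sign of \<open>Im z\<close>, determines the face.\<close>
    define h where "h = 1 - \<bar>Im z\<bar>"
    have le_m: "Re z \<le> real m * h"
      if "0 < h" "real r * h < Re z" "Re z < (real r + 1) * h" "r < m" for r
    proof -
      have "(real r + 1) * h \<le> real m * h" using that by (intro mult_right_mono) auto
      with that show ?thesis by linarith
    qed
    have le_m1: "Re z \<le> real m * h" if "0 < h" "Re z < h"
    proof -
      have "1 * h \<le> real m * h" using that m by (intro mult_right_mono) auto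
      with that show ?thesis by linarith
    qed
    \<comment> \<open>Otherwise \<open>Re z / h\<close> would lie in two disjoint open unit
      intervals.\<close>
    have same: "\<not> r < r'" if "0 < h" "Re z < (real r + 1) * h" "real r' * h < Re z" for r r'
    proof
      assume "r < r'"
      then have "(real r + 1) * h \<le> real r' * h" using that by (intro mult_right_mono) auto
      with that show False by linarith
    qed
    from C z(1) m show False
    proof (cases rule: fan_faces_cases)
      case c: inner
      from D z(2) m show False
      proof (cases rule: fan_faces_cases)
        case inner with c \<open>C \<noteq> D\<close> show False by simp
      next
        case outer with c le_m1 show False by (auto simp: h_def)
      next
        case (spoke s r)
        with c fan_sector_bounds[OF spoke(2,5,6,7,3)] show False by simp
      qed
    next
      case c: outer
      from D z(2) m show False
      proof (cases rule: fan_faces_cases)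
        case inner with c le_m1 show False by (auto simp: h_def)
      next
        case outer with c \<open>C \<noteq> D\<close> show False by simp
      next
        case (spoke s r)
        with c fan_sector_bounds[OF spoke(2,5,6,7,3)] le_m[of r] show False by (auto simp: h_def)
      qed
    next
      case c: (spoke s r)
      note cb = fan_sector_bounds[OF c(2,5,6,7,3)]
      from D z(2) m show False
      proof (cases rule: fan_faces_cases)
        case inner with c cb show False by simp
      next
        case outer with c cb le_m[of r] show False by (auto simp: h_def)
      next
        case d: (spoke s' r')
        note db = fan_sector_bounds[OF d(2,5,6,7,3)]
        have "s = s'" using c(2,5) d(2,5) by auto
        moreover have "r = r'"
          using c(3,6,7) d(3,6,7) cb db same[of r r'] same[of r' r] by (simp add: h_def)
        ultimately show False using c(1) d(1) \<open>C \<noteq> D\<close> by simp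
      qed
    qed
  qed
  then show ?thesis by blast
qed

lemma fan_faces_Union:
  assumes m: "m \<ge> 1"
  shows "- (\<Union>e\<in>fan_edges m. convex hull e) = \<Union>(fan_faces m)"
proof (intro equalityI subsetI)
  fix z assume z: "z \<in> \<Union>(fan_faces m)"
  then obtain C where C: "C \<in> fan_faces m" "z \<in> C" by blast
  have False if e: "e \<in> fan_edges m" "z \<in> convex hull e" for e
  proof -
    from C m consider (inner) "0 < Re z" "Re z < 1 - \<bar>Im z\<bar>"
      | (outer) "\<not> (0 \<le> Re z \<and> Re z \<le> real m * (1 - \<bar>Im z\<bar>))"
      | (spoke) s r where "s = 1 \<or> s = -1" "1 \<le> r" 
      "0 < s * Im z" "real r * (1 - s * Im z) < Re z" "Re z < (real r + 1) * (1 - s * Im z)"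
      by (cases rule: fan_faces_cases) blast+
    note face = this
    from e show False
    proof (cases rule: mem_fan_edge_cases)
      case apexes
      from face show False
      proof cases
        case (spoke s r)
        with fan_sector_bounds[OF spoke(1,3,4,5,2)] apexes show False by simp
      qed (use apexes in auto)
    next
      case e: (spoke s r)
      have s: "s * Im z = \<bar>Im z\<bar>" "\<bar>Im z\<bar> \<le> 1" using e by auto
      define h where "h = 1 - \<bar>Im z\<bar>"
      have x: "Re z = real r * h" using e(7) s(1) by (simp add: h_def)
      have h0: "0 \<le> h" using s(2) by (simp add: h_def)
      have x0: "0 \<le> Re z" unfolding x using h0 by simp
      from face show False
      proof cases
        case inner
        then have "Re z < h" by (simp add: h_def)
        moreover have "1 * h \<le> real r * h"
          using e h0 by (intro mult_right_mono) auto
        ultimately show False using x by linarith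
      next
        case outer
        then have "\<not> (0 \<le> Re z \<and> Re z \<le> real m * h)" by (simp add: h_def)
        moreover have "real r * h \<le> real m * h"
          using e h0 by (intro mult_right_mono) auto
        ultimately show False using x x0 by linarith
      next
        case (spoke s' r')
        note b = fan_sector_bounds[OF spoke(1,3,4,5,2)]
        have "0 < h" using b(2) by (simp add: h_def)
        \<comment> \<open>A point of a spoke projects to an integer on the axis, a point of a sector
          strictly between two consecutive integers.\<close>
        have "real r' * h < real r * h" "real r * h < (real r' + 1) * h"
          using spoke(4,5) unfolding b(1) h_def[symmetric] x by simp_all
        then have "real r' < real r" "real r < real r' + 1"
          using \<open>0 < h\<close> by (simp_all only: mult_less_cancel_right_pos)
        then show False by simp
      qed
    next
      case e: (axis r)
      from face show False
      proof cases
        case outer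
        with e show False by auto
      qed (use e in auto)
    qed
  qed
  then show "z \<in> - (\<Union>e\<in>fan_edges m. convex hull e)" by blast
next
  fix z assume z: "z \<in> - (\<Union>e\<in>fan_edges m. convex hull e)"
  have apexes: "\<not> (Re z = 0 \<and> \<bar>Im z\<bar> \<le> 1)"
    using z mem_segment_apexes[of z] unfolding fan_edges_def by blast
  have spoke: "\<not> (0 \<le> s * Im z \<and> s * Im z \<le> 1 \<and> Re z = real r * (1 - s * Im z))"
    if "s = 1 \<or> s = -1" "1 \<le> r" "r \<le> m" for s r
  proof -
    have "s * s = 1" "{Complex 0 s, Complex (real r) 0} \<in> fan_edges m"
      using that unfolding fan_edges_def by auto
    then show ?thesis using z mem_segment_apex[of s z "real r"] by blast
  qed
  have axis: "\<not> (Im z = 0 \<and> real r \<le> Re z \<and> Re z \<le> real r + 1)" if "1 \<le> r" "r < m" for r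
  proof -
    have "{Complex (real r) 0, Complex (real r + 1) 0} \<in> fan_edges m"
      using that unfolding fan_edges_def by auto
    then show ?thesis using z mem_segment_axis[of "real r" "real r + 1" z] by auto
  qed
  define h where "h = 1 - \<bar>Im z\<bar>"
  show "z \<in> \<Union>(fan_faces m)"
  proof (cases "0 \<le> Re z \<and> Re z \<le> real m * h")
    case False
    then have "z \<in> - (convex hull {Complex 0 1, Complex 0 (-1), Complex (real m) 0})"
      using m by (simp add: mem_triangle_apexes h_def)
    then show ?thesis unfolding fan_faces_def by blast
  next
    case True
    then have "0 \<le> real m * h" by linarith
    then have "0 \<le> h" using m by (simp add: zero_le_mult_iff)
    \<comment> \<open>\<open>Re z = 0\<close> would put \<open>z\<close> on the edge between the
      apexes; after that, \<open>h = 0\<close> would contradict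
      \<open>Re z \<le> real m * h\<close>.\<close>
    then have "0 < Re z" using True apexes by (auto simp: h_def)
    then have "h \<noteq> 0" using True by auto
    then have "0 < h" using \<open>0 \<le> h\<close> by simp
    show ?thesis
    proof (cases "Re z < h")
      case True
      then have "z \<in> interior (convex hull {Complex 0 1, Complex 0 (-1), Complex 1 0})"
        using \<open>0 < Re z\<close> by (simp add: mem_interior_triangle_apexes h_def)
      then show ?thesis unfolding fan_faces_def by blast
    next
      case False
      define s :: real where "s = (if Im z \<ge> 0 then 1 else -1)"
      have s: "s = 1 \<or> s = -1" "s * Im z = \<bar>Im z\<bar>" by (auto simp: s_def)
      \<comment> \<open>The projection of \<open>z\<close> to the axis lies between \<open>r\<close>
        and \<open>r + 1\<close>. Avoiding the spoke to \<open>r\<close> makes the lower bound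
        strict and gives \<open>r < m\<close>; avoiding the axis edge then gives
        \<open>Im z \<noteq> 0\<close>.\<close>
      define r where "r = nat \<lfloor>Re z / h\<rfloor>"
      have t: "1 \<le> Re z / h" "Re z / h \<le> real m"
        using False True \<open>0 < h\<close> by (auto simp: field_simps)
      then have r: "1 \<le> r" "real r \<le> Re z / h" "Re z / h < real r + 1"
        unfolding r_def by (auto simp: le_nat_iff le_floor_iff)
      then have "r \<le> m" using t by linarith
      have ne: "Re z \<noteq> real r * h"
        using spoke[OF s(1) r(1) \<open>r \<le> m\<close>] \<open>0 < h\<close> s(2) by (auto simp: h_def)
      then have "Re z / h \<noteq> real r" using \<open>0 < h\<close> by (auto simp: field_simps)
      then have "r < m" using r t \<open>r \<le> m\<close> by (cases "r = m") auto
      have b: "real r * h < Re z" "Re z < (real r + 1) * h"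
        using r ne \<open>0 < h\<close> by (auto simp: field_simps)
      have "Im z \<noteq> 0"
        using axis[OF r(1) \<open>r < m\<close>] b by (auto simp: h_def)
      moreover have "s * s = 1" using s by auto
      ultimately have "z \<in> interior (convex hull {Complex 0 s, Complex (real r) 0, Complex (real r + 1) 0})"
        using b s by (simp add: mem_interior_triangle_axis h_def)
      then show ?thesis
        using s(1) r(1) \<open>r < m\<close> unfolding fan_faces_def by blast
    qed
  qed
qed

section \<open>The double fan as a plane triangulation\<close>

definition double_fan :: "nat \<Rightarrow> drawn_graph" where
  "double_fan m = straight_drawing (fan_vertices m) (fan_edges m)"

lemma plane_triangulation_double_fan:
  assumes m: "m \<ge> 1"
  shows "plane_triangulation (double_fan m)"
  unfolding plane_triangulation_def
proof
  show "plane_graph (double_fan m)"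
    unfolding double_fan_def
  proof (rule plane_graph_straight_drawing)
    show "finite (fan_vertices m)" by (simp add: fan_vertices_def)
    show "e \<subseteq> fan_vertices m \<and> card e = 2" if "e \<in> fan_edges m" for e
      using that fan_edge_subset card_fan_edge by blast
  qed (use fan_vertices_covered fan_edges_cross in blast)+
  show "\<forall>F\<in>faces (double_fan m). bounded_by_triangle (double_fan m) F"
  proof
    fix F assume F: "F \<in> faces (double_fan m)"
    have comp: "F \<in> components (- (\<Union>e\<in>fan_edges m. convex hull e))"
      using F faces_straight_drawing[OF card_fan_edge fan_vertices_covered]
      by (simp add: double_fan_def)
    have "F \<in> fan_faces m"
    proof (rule component_of_open_partition[OF comp fan_faces_Union[OF m]])
      fix C assume C: "C \<in> fan_faces m"
      have "closed (convex hull {Complex 0 1, Complex 0 (-1), Complex (real m) 0})"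
        by (intro compact_imp_closed finite_imp_compact_convex_hull) simp
      then show "open C"
        using C unfolding fan_faces_def by (auto simp: open_Compl)
      have "connected (- (convex hull {Complex 0 1, Complex 0 (-1), Complex (real m) 0}))"
        by (rule connected_complement_bounded_convex) (auto intro: finite_imp_bounded_convex_hull)
      moreover have "connected (interior (convex hull {a, b, c}))" for a b c :: complex
        by (intro convex_connected convex_interior convex_convex_hull)
      ultimately show "connected C"
        using C unfolding fan_faces_def by auto
    qed (use fan_faces_disjoint m in blast)
    \<comment> \<open>This supplies the nondegeneracy demanded of open triangles.\<close>
    moreover have "F \<noteq> {}" using comp by (rule in_components_nonempty)
    ultimately consider
        (inner) "F = interior (convex hull {Complex 0 1, Complex 0 (-1), Complex 1 0})"
      | (outer) "F = - (convex hull {Complex 0 1, Complex 0 (-1), Complex (real m) 0})"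
      | (spoke) s r where
          "F = interior (convex hull {Complex 0 s, Complex (real r) 0, Complex (real r + 1) 0})"
          "s = 1 \<or> s = -1" "1 \<le> r" "r < m"
      unfolding fan_faces_def by blast
    note face = this
    note tri = bounded_by_triangle_straight_drawing[OF _ _ _ card_fan_edge]
    from face show "bounded_by_triangle (double_fan m) F"
      unfolding double_fan_def
    proof cases
      case inner
      show "bounded_by_triangle (straight_drawing (fan_vertices m) (fan_edges m)) F"
        using apexes_fan_edge spoke_fan_edge[of "-1" 1] spoke_fan_edge[of 1 1] m inner \<open>F \<noteq> {}\<close>
        by (intro tri[of "Complex 0 1" "Complex 0 (-1)" _ "Complex 1 0"]) simp_all
    next
      case outer
      show "bounded_by_triangle (straight_drawing (fan_vertices m) (fan_edges m)) F"
        using apexes_fan_edge spoke_fan_edge[of "-1" m] spoke_fan_edge[of 1 m] m outer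
        by (intro tri[of "Complex 0 1" "Complex 0 (-1)" _ "Complex (real m) 0"]) simp_all
    next
      case (spoke s r)
      have "{Complex 0 s, Complex (real r + 1) 0} \<in> fan_edges m"
        using spoke_fan_edge[of s "Suc r" m] spoke by (simp add: add.commute)
      then show "bounded_by_triangle (straight_drawing (fan_vertices m) (fan_edges m)) F"
        using spoke_fan_edge[of s r m] axis_fan_edge[of r m] spoke \<open>F \<noteq> {}\<close>
        by (intro tri[of "Complex 0 s" "Complex (real r) 0" _ "Complex (real r + 1) 0"]) simp_all
    qed
  qed
qed

section \<open>Numbering of the vertices and the contained path\<close>

definition pos :: "nat \<Rightarrow> complex" where
  "pos i = (if i = 0 then Complex 0 1 else if i = 1 then Complex 0 (-1) else Complex (real (i - 1)) 0)"

lemma inj_pos: "inj pos"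
  by (rule injI) (auto simp: pos_def split: if_splits)

lemma vimage_pos_pair: "pos -` {pos i, pos j} = {i, j}"
  using inj_pos by (auto dest: injD)

lemma pos_in_fan_vertices:
  assumes "i < m + 2"
  shows "pos i \<in> fan_vertices m"
proof -
  consider "i = 0" | "i = 1" | "2 \<le> i" by linarith
  then show ?thesis
  proof cases
    case 3
    then have "pos i = Complex (real (i - 1)) 0" "i - 1 \<in> {1..m}"
      using assms by (auto simp: pos_def)
    then show ?thesis unfolding fan_vertices_def by blast
  qed (simp_all add: pos_def fan_vertices_def)
qed

lemma fan_vertices_eq: "fan_vertices m = pos ` {..<m + 2}"
proof
  show "pos ` {..<m + 2} \<subseteq> fan_vertices m"
    using pos_in_fan_vertices by blast
  show "fan_vertices m \<subseteq> pos ` {..<m + 2}"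
  proof
    fix v assume "v \<in> fan_vertices m"
    then consider "v = Complex 0 1" | "v = Complex 0 (-1)"
      | r where "v = Complex (real r) 0" "1 \<le> r" "r \<le> m"
      unfolding fan_vertices_def by auto
    then have "\<exists>i<m + 2. v = pos i"
    proof cases
      case 1
      then show ?thesis by (intro exI[of _ 0]) (simp add: pos_def)
    next
      case 2
      then show ?thesis by (intro exI[of _ 1]) (simp add: pos_def)
    next
      case (3 r)
      then show ?thesis by (intro exI[of _ "Suc r"]) (simp add: pos_def)
    qed
    then show "v \<in> pos ` {..<m + 2}" by blast
  qed
qed

lemma fan_edge_from_apex:
  assumes "i < j" "i < 2" "j < m + 2"
  shows "{pos i, pos j} \<in> fan_edges m"
proof (cases "j = 1")
  case True
  with assms have "i = 0" by simp
  with True show ?thesis using apexes_fan_edge by (simp add: pos_def)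
next
  case False
  then have "pos j = Complex (real (j - 1)) 0" using assms by (simp add: pos_def)
  moreover have "i = 0 \<or> i = 1" using assms by linarith
  then have "pos i = Complex 0 1 \<or> pos i = Complex 0 (-1)" by (auto simp: pos_def)
  ultimately show ?thesis
    using spoke_fan_edge[of 1 "j - 1" m] spoke_fan_edge[of "-1" "j - 1" m] False assms by auto
qed

text \<open>The order of \<open>pos\<close> is a Hamiltonian path: the two apexes, then the axis
  from left to right. Without index 0 it is the path that the colouring cuts into blocks.\<close>

lemma fan_edge_successive:
  assumes "Suc i < m + 2"
  shows "{pos i, pos (Suc i)} \<in> fan_edges m"
proof (cases "i < 2")
  case True
  with assms show ?thesis by (intro fan_edge_from_apex) auto
next
  case False
  then have "pos i = Complex (real (i - 1)) 0" "pos (Suc i) = Complex (real (i - 1) + 1) 0"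
    by (auto simp: pos_def)
  then show ?thesis
    using axis_fan_edge[of "i - 1" m] assms False by auto
qed

lemma double_fan_contains_path:
  assumes "k \<le> m + 2"
  shows "\<exists>S. is_copy S (path_graph k) (double_fan m)"
proof
  let ?S = "\<lparr>verts = pos ` {0..<k}, edges = {{pos i, pos (Suc i)} | i. Suc i < k}\<rparr>"
  have neq: "pos i \<noteq> pos (Suc i)" for i
    using inj_pos by (auto dest: injD)
  have iff: "{pos i, pos j} \<in> {{pos i, pos (Suc i)} | i. Suc i < k} \<longleftrightarrow>
      {i, j} \<in> {{i, Suc i} | i. Suc i < k}" for i j
    using inj_image_eq_iff[OF inj_pos, of "{i, j}" "{a, Suc a}" for a] by simp
  have "subgraph ?S (double_fan m)"
    using assms neq pos_in_fan_vertices[of _ m] fan_edge_successive[of _ m]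
    by (auto simp: subgraph_def simple_graph_def double_fan_def straight_drawing_def)
  moreover have "isomorphic ?S (path_graph k)"
    unfolding isomorphic_def
  proof (intro exI[of _ "inv pos"] conjI)
    show "bij_betw (inv pos) (verts ?S) (verts (path_graph k))"
      using inj_pos by (auto simp: bij_betw_def path_graph_def inj_on_def image_image inj_imp_surj_inv)
    show "\<forall>u\<in>verts ?S. \<forall>v\<in>verts ?S.
        ({u, v} \<in> edges ?S) = ({inv pos u, inv pos v} \<in> edges (path_graph k))"
      using iff by (simp add: path_graph_def inv_f_f[OF inj_pos])
  qed
  ultimately show "is_copy ?S (path_graph k) (double_fan m)"
    by (simp add: is_copy_def)
qed

lemma double_fan_in_triangulations:
  assumes "1 \<le> m" "k \<le> m + 2"
  shows "double_fan m \<in> triangulations (m + 2) (path_graph k)"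
proof -
  have "card (verts (double_fan m)) = m + 2"
    using inj_pos by (simp add: double_fan_def straight_drawing_def fan_vertices_eq card_image inj_on_def)
  with assms show ?thesis
    by (simp add: triangulations_def plane_triangulation_double_fan double_fan_contains_path)
qed

section \<open>Colourings\<close>

text \<open>\<open>Max\<close> needs a finite set, so the numbers of colours are bounded first. The
  crude bound \<open>2 ^ n\<close> suffices, edges being sets of vertices.\<close>

lemma card_colours_le_planar_anti_ramsey:
  assumes "T \<in> triangulations n H" "\<not> (\<exists>S. is_copy S H T \<and> rainbow c S)"
  shows "card (c ` edges T) \<le> planar_anti_ramsey n H"
proof -
  let ?A = "{card (c ` edges T) | T c.
      T \<in> triangulations n H \<and> \<not> (\<exists>S. is_copy S H T \<and> rainbow c S)}"
  have "card (c ` edges T) \<le> 2 ^ n" if "T \<in> triangulations n H" for T c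
  proof -
    have T: "finite (verts T)" "edges T \<subseteq> Pow (verts T)" "card (verts T) = n"
      using that by (auto simp: triangulations_def plane_triangulation_def plane_graph_def simple_graph_def)
    then have "finite (edges T)" using finite_subset by blast
    then have "card (c ` edges T) \<le> card (edges T)" by (rule card_image_le)
    also have "\<dots> \<le> card (Pow (verts T))" using T by (intro card_mono) auto
    finally show ?thesis using T by (simp add: card_Pow)
  qed
  then have "?A \<subseteq> {..2 ^ n}" by auto
  then have "finite ?A" using finite_subset by blast
  moreover have "card (c ` edges T) \<in> ?A" using assms by blast
  ultimately show ?thesis unfolding planar_anti_ramsey_def by (rule Max_ge)
qed

section \<open>Paths that rarely change block\<close>

lemma card_image_le_changes:
  fixes g :: "nat \<Rightarrow> 'a"
  shows "card (g ` {..l}) \<le> 1 + card {i. i < l \<and> g i \<noteq> g (Suc i)}"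
proof (induction l)
  case 0
  then show ?case by simp
next
  case (Suc l)
  let ?D = "\<lambda>l. {i. i < l \<and> g i \<noteq> g (Suc i)}"
  have fin: "finite (?D l)" by simp
  show ?case
  proof (cases "g l = g (Suc l)")
    case True
    then have "g (Suc l) \<in> g ` {..l}" by (intro image_eqI[of _ _ l]) simp_all
    then have "card (g ` {..Suc l}) = card (g ` {..l})" by (simp add: atMost_Suc insert_absorb)
    moreover have "?D l \<subseteq> ?D (Suc l)" by auto
    then have "card (?D l) \<le> card (?D (Suc l))" by (intro card_mono) auto
    ultimately show ?thesis using Suc by linarith
  next
    case False
    have "card (g ` {..Suc l}) \<le> Suc (card (g ` {..l}))"
      by (simp add: atMost_Suc card_insert_if)
    moreover have "?D (Suc l) = insert l (?D l)" using False by (auto simp: less_Suc_eq)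
    then have "card (?D (Suc l)) = Suc (card (?D l))" using fin by simp
    ultimately show ?thesis using Suc by linarith
  qed
qed

text \<open>Index 0 is alone in its block. Steps at 0 give at most two changes of block and
  \<open>one\<close> allows one more, so at most four blocks are met: that of 0 and three others, of
  which only \<open>M\<close> may exceed two vertices.\<close>

lemma path_length_le:
  fixes p b :: "nat \<Rightarrow> nat"
  assumes inj: "inj_on p {..<k}" and N: "p ` {..<k} \<subseteq> N" "finite N"
    and centre: "\<And>x. x \<in> N \<Longrightarrow> b x = b 0 \<Longrightarrow> x = 0"
    and block: "\<And>s. card {x \<in> N. b x = s} \<le> 2 + (if s = M then t else 0)"
    and one: "\<And>i j. Suc i < k \<Longrightarrow> Suc j < k \<Longrightarrow>
      p i \<noteq> 0 \<Longrightarrow> p (Suc i) \<noteq> 0 \<Longrightarrow> b (p i) \<noteq> b (p (Suc i)) \<Longrightarrow>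
      p j \<noteq> 0 \<Longrightarrow> p (Suc j) \<noteq> 0 \<Longrightarrow> b (p j) \<noteq> b (p (Suc j)) \<Longrightarrow> i = j"
  shows "k \<le> 7 + t"
proof (cases k)
  case 0
  then show ?thesis by simp
next
  case (Suc l)
  let ?B = "(b \<circ> p) ` {..l}"
  let ?block = "\<lambda>s. {x \<in> N. b x = s}"
  define D where "D = {i. i < l \<and> (b \<circ> p) i \<noteq> (b \<circ> p) (Suc i)}"
  define X where "X = {i. i < l \<and> p i \<noteq> 0 \<and> p (Suc i) \<noteq> 0 \<and> b (p i) \<noteq> b (p (Suc i))}"
  have B: "card ?B \<le> 1 + card D"
    unfolding D_def by (rule card_image_le_changes)
  have "finite X" by (simp add: X_def)
  have "card X \<le> 1"
    by (rule card_le_Suc0_iff_eq[THEN iffD2, OF \<open>finite X\<close>, simplified One_nat_def[symmetric]])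
       (use one Suc in \<open>auto simp: X_def\<close>)
  have Suc_l: "{..<k} = {..l}" using Suc by auto
  \<comment> \<open>The surplus \<open>t\<close> belongs to block \<open>M\<close> only, so it is
    counted at most once.\<close>
  have sum_le: "(\<Sum>s\<in>A. card (?block s)) \<le> 2 * card A + t" if "finite A" for A
  proof -
    have "(\<Sum>s\<in>A. card (?block s)) \<le> (\<Sum>s\<in>A. 2 + (if s = M then t else 0))"
      by (intro sum_mono block)
    also have "\<dots> \<le> 2 * card A + t"
      unfolding sum.distrib using that by (simp add: sum.delta)
    finally show ?thesis .
  qed
  have "k = card (p ` {..l})" using inj Suc_l by (metis card_image card_lessThan)
  also have "\<dots> \<le> card (\<Union>s\<in>?B. ?block s)"
    using N Suc_l by (intro card_mono) auto
  also have "\<dots> \<le> (\<Sum>s\<in>?B. card (?block s))"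
    by (intro card_UN_le) simp
  finally have k: "k \<le> (\<Sum>s\<in>?B. card (?block s))" .
  show ?thesis
  proof (cases "0 \<in> p ` {..l}")
    case False
    then have "p i \<noteq> 0" if "i \<le> l" for i using that by auto
    \<comment> \<open>A path that misses 0 has at most one change of block, so it meets at most two
      blocks.\<close>
    then have "D \<subseteq> X" by (auto simp: D_def X_def)
    then have "card D \<le> 1" using \<open>finite X\<close> \<open>card X \<le> 1\<close> card_mono order_trans by blast
    then have "card ?B \<le> 2" using B by linarith
    then show ?thesis using k sum_le[of ?B] by simp
  next
    case True
    then obtain q where q: "q \<le> l" "p q = 0" by auto
    have uniq: "i = q" if "i \<le> l" "p i = 0" for i
      using inj that q Suc_l by (auto simp: inj_on_def)
    \<comment> \<open>A change outside \<open>X\<close> is a step into or out of 0, which sits at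
      position \<open>q\<close>. For \<open>q = 0\<close> the term \<open>q - 1\<close> is again 0,
      which is harmless.\<close>
    have "D \<subseteq> X \<union> {q, q - 1}"
    proof
      fix i assume "i \<in> D"
      then show "i \<in> X \<union> {q, q - 1}"
        using uniq[of i] uniq[of "Suc i"]
        by (cases "p i = 0"; cases "p (Suc i) = 0") (auto simp: D_def X_def)
    qed
    then have "card D \<le> card (X \<union> {q, q - 1})" using \<open>finite X\<close> by (intro card_mono) auto
    also have "\<dots> \<le> card X + card {q, q - 1}" by (rule card_Un_le)
    also have "\<dots> \<le> 3" using \<open>card X \<le> 1\<close> card_insert_le_m1[of 2 "{q - 1}" q] by (simp add: card_insert_if)
    finally have "card ?B \<le> 4" using B by linarith
    moreover have b0: "b 0 \<in> ?B" using q by force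
    ultimately have "card (?B - {b 0}) \<le> 3" by simp
    then have rest: "(\<Sum>s\<in>?B - {b 0}. card (?block s)) \<le> 6 + t"
      using sum_le[of "?B - {b 0}"] by simp
    have "?block (b 0) \<subseteq> {0}" using centre by blast
    then have "card (?block (b 0)) \<le> card {0 :: nat}" by (intro card_mono) auto
    then have "(\<Sum>s\<in>?B. card (?block s)) \<le> 7 + t"
      using rest sum.remove[OF _ b0, of "\<lambda>s. card (?block s)"] by simp
    with k show ?thesis by (rule order_trans)
  qed
qed

section \<open>The colouring\<close>

definition block :: "nat \<Rightarrow> nat \<Rightarrow> nat" where
  "block M i = min (Suc i div 2) M"

text \<open>On indices below \<open>n\<close>, \<open>Max e\<close> is the other end of an edge at
  0, hence between 1 and \<open>n - 1\<close>. Edges inside blocks use colours above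
  \<open>n\<close>, where \<open>Min e\<close> separates consecutive pairs even in a block of three.
  This leaves 0 as the shared colour.\<close>

definition edge_colour :: "nat \<Rightarrow> nat \<Rightarrow> nat set \<Rightarrow> nat" where
  "edge_colour n M e =
     (if 0 \<in> e then Max e else if card (block M ` e) = 1 then n + Min e else 0)"

definition fan_colour :: "nat \<Rightarrow> nat \<Rightarrow> complex set \<Rightarrow> nat" where
  "fan_colour m M e = edge_colour (m + 2) M (pos -` e)"

lemma fan_colour_pair: "fan_colour m M {pos i, pos j} = edge_colour (m + 2) M {i, j}"
  by (simp add: fan_colour_def vimage_pos_pair)

text \<open>A block \<open>s\<close> below \<open>M\<close> has at most the members
  \<open>2 * s - 1\<close> and \<open>2 * s\<close>, and only 0 if \<open>s = 0\<close>. The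
  \<open>min\<close> in \<open>block\<close> makes block \<open>M\<close> absorb all later indices,
  which the second hypothesis limits.\<close>

lemma card_block_le:
  assumes "1 \<le> M" "n \<le> 2 * M + 1 + t"
  shows "card {x \<in> {..<n}. block M x = s} \<le> 2 + (if s = M then t else 0)"
proof (cases "s = M")
  case True
  then have "{x \<in> {..<n}. block M x = s} \<subseteq> {2 * M - 1..<2 * M + 1 + t}"
    using assms by (auto simp: block_def min_def split: if_splits)
  from card_mono[OF _ this] show ?thesis using True assms by simp
next
  case False
  then have "{x \<in> {..<n}. block M x = s} \<subseteq> {2 * s - 1..<2 * s + 1}"
    by (auto simp: block_def min_def split: if_splits)
  from card_mono[OF _ this] show ?thesis using False by simp
qed

text \<open>The shared colour and the \<open>m + 1\<close> colours at index 0 make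
  \<open>m + 2\<close>; each path edge inside a block adds one.\<close>

lemma card_fan_colours:
  assumes "2 \<le> M" "2 \<le> m"
  shows "m + 2 + card {i. 1 \<le> i \<and> Suc i < m + 2 \<and> block M i = block M (Suc i)}
    \<le> card (fan_colour m M ` edges (double_fan m))"
proof -
  define I where "I = {i. 1 \<le> i \<and> Suc i < m + 2 \<and> block M i = block M (Suc i)}"
  have edges: "edges (double_fan m) = fan_edges m"
    by (simp add: double_fan_def straight_drawing_def)
  have "fan_edges m \<subseteq> Pow (fan_vertices m)" using fan_edge_subset by blast
  then have fin: "finite (fan_edges m)"
    by (rule finite_subset) (simp add: fan_vertices_eq)
  have "x \<in> fan_colour m M ` fan_edges m" if x: "x \<in> {..<m + 2} \<union> (\<lambda>i. m + 2 + i) ` I" for x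
  proof -
    consider "x = 0" | "1 \<le> x" "x < m + 2" | i where "i \<in> I" "x = m + 2 + i"
      using x by (cases "x = 0") auto
    then show ?thesis
    proof cases
      case 1
      \<comment> \<open>The shared colour occurs on the edge from the lower apex to index 3, whose
        ends lie in blocks 1 and 2 because \<open>2 \<le> M\<close>.\<close>
      have "block M ` {1, 3} = {1, 2}" using assms by (simp add: block_def)
      then have "fan_colour m M {pos 1, pos 3} = x"
        using 1 unfolding fan_colour_pair edge_colour_def by simp
      moreover have "{pos 1, pos 3} \<in> fan_edges m"
        using assms by (intro fan_edge_from_apex) auto
      ultimately show ?thesis by blast
    next
      case 2
      then have "fan_colour m M {pos 0, pos x} = x"
        unfolding fan_colour_pair edge_colour_def by simp
      moreover have "{pos 0, pos x} \<in> fan_edges m"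
        using 2 by (intro fan_edge_from_apex) auto
      ultimately show ?thesis by (metis image_eqI)
    next
      case (3 i)
      then have "fan_colour m M {pos i, pos (Suc i)} = x"
        unfolding fan_colour_pair edge_colour_def I_def by simp
      moreover have "{pos i, pos (Suc i)} \<in> fan_edges m"
        using 3 by (intro fan_edge_successive) (simp add: I_def)
      ultimately show ?thesis by (metis image_eqI)
    qed
  qed
  then have "card ({..<m + 2} \<union> (\<lambda>i. m + 2 + i) ` I) \<le> card (fan_colour m M ` fan_edges m)"
    using fin by (intro card_mono) auto
  moreover have "finite I" unfolding I_def by (rule finite_subset[of _ "{..<m + 2}"]) auto
  then have "card ({..<m + 2} \<union> (\<lambda>i. m + 2 + i) ` I)
      = card {..<m + 2} + card ((\<lambda>i. m + 2 + i) ` I)"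
    by (intro card_Un_disjoint) auto
  moreover have "card ((\<lambda>i. m + 2 + i) ` I) = card I"
    by (rule card_image) (simp add: inj_on_def)
  ultimately show ?thesis unfolding edges I_def[symmetric] by (simp only: card_lessThan)
qed

text \<open>Edges that avoid index 0 and join two blocks all have colour 0, so a rainbow path
  contains at most one of them and \<open>path_length_le\<close> applies.\<close>

lemma no_rainbow_path:
  assumes M: "1 \<le> M" "m + 2 \<le> 2 * M + 1 + t" and k: "7 + t < k"
  shows "\<not> (\<exists>S. is_copy S (path_graph k) (double_fan m) \<and> rainbow (fan_colour m M) S)"
proof
  assume "\<exists>S. is_copy S (path_graph k) (double_fan m) \<and> rainbow (fan_colour m M) S"
  then obtain S where copy: "is_copy S (path_graph k) (double_fan m)"
    and rainbow: "inj_on (fan_colour m M) (edges S)"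
    by (auto simp: rainbow_def)
  have S: "verts S \<subseteq> fan_vertices m"
    using copy by (simp add: is_copy_def subgraph_def double_fan_def straight_drawing_def)
  obtain f where f: "bij_betw f (verts S) {0..<k}"
    and iso: "\<forall>u\<in>verts S. \<forall>v\<in>verts S.
      {u, v} \<in> edges S \<longleftrightarrow> {f u, f v} \<in> {{i, Suc i} | i. Suc i < k}"
    using copy unfolding is_copy_def isomorphic_def path_graph_def graph.simps by blast
  \<comment> \<open>\<open>g\<close> lists the vertices of the copy in path order; \<open>p\<close>
    below gives their indices under \<open>pos\<close>.\<close>
  define g where "g = inv_into (verts S) f"
  have g: "g i \<in> verts S" "f (g i) = i" if "i < k" for i
    using that f unfolding g_def bij_betw_def by (auto intro: inv_into_into f_inv_into_f)
  define p where "p i = inv pos (g i)" for i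
  have p: "pos (p i) = g i" "p i < m + 2" if "i < k" for i
  proof -
    from g(1)[OF that] S obtain j where j: "j < m + 2" "g i = pos j"
      by (auto simp: fan_vertices_eq)
    then have "p i = j" by (simp add: p_def inv_f_f[OF inj_pos])
    with j show "pos (p i) = g i" "p i < m + 2" by simp_all
  qed
  have "k \<le> 7 + t"
  proof (rule path_length_le)
    show "inj_on p {..<k}"
      by (rule inj_onI) (metis lessThan_iff p(1) g(2))
    show "p ` {..<k} \<subseteq> {..<m + 2}" using p(2) by auto
    show "finite {..<m + 2}" by simp
    show "x = 0" if "block M x = block M 0" for x
      using that M(1) by (auto simp: block_def min_def split: if_splits)
    show "card {x \<in> {..<m + 2}. block M x = s} \<le> 2 + (if s = M then t else 0)" for s
      using M by (rule card_block_le)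
    fix i j assume i: "Suc i < k" "p i \<noteq> 0" "p (Suc i) \<noteq> 0" "block M (p i) \<noteq> block M (p (Suc i))"
      and j: "Suc j < k" "p j \<noteq> 0" "p (Suc j) \<noteq> 0" "block M (p j) \<noteq> block M (p (Suc j))"
    have *: "{g i, g (Suc i)} \<in> edges S \<and> fan_colour m M {g i, g (Suc i)} = 0"
      if "Suc i < k" "p i \<noteq> 0" "p (Suc i) \<noteq> 0" "block M (p i) \<noteq> block M (p (Suc i))" for i
    proof
      have "i < k" using that by simp
      then show "{g i, g (Suc i)} \<in> edges S"
        using iso[rule_format, OF g(1) g(1), of i "Suc i"] g(2) that(1) by auto
      have "fan_colour m M {g i, g (Suc i)} = edge_colour (m + 2) M {p i, p (Suc i)}"
        using fan_colour_pair p(1)[OF \<open>i < k\<close>] p(1)[OF that(1)] by metis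
      then show "fan_colour m M {g i, g (Suc i)} = 0"
        using that by (simp add: edge_colour_def)
    qed
    have "{g i, g (Suc i)} = {g j, g (Suc j)}"
      using *[OF i] *[OF j] by (intro inj_onD[OF rainbow]) simp_all
    then have "f ` {g i, g (Suc i)} = f ` {g j, g (Suc j)}" by simp
    then have "{i, Suc i} = {j, Suc j}" using i(1) j(1) g(2) by simp
    then show "i = j" by (auto simp: doubleton_eq_iff)
  qed
  with k show False by simp
qed

text \<open>Every path edge that starts at an odd index lies inside a block. If \<open>e = 1\<close>
  and \<open>n\<close> is even, the last block has three members and also contains the edge starting
  at the even index \<open>n - 2\<close>.\<close>

lemma card_constant_block_edges:
  assumes "4 \<le> n" "e \<le> 1"
  shows "(n - 1) div 2 + (if e = 1 \<and> even n then 1 else 0)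
    \<le> card {i. 1 \<le> i \<and> Suc i < n \<and> block ((n - e) div 2) i = block ((n - e) div 2) (Suc i)}"
    (is "_ \<le> card ?I")
proof -
  let ?O = "(\<lambda>j. 2 * j + 1) ` {..<(n - 1) div 2}"
  have "card ?O = (n - 1) div 2" by (simp add: card_image inj_on_def)
  have fin: "finite ?I" by (rule finite_subset[of _ "{..<n}"]) auto
  have O: "?O \<subseteq> ?I" by (auto simp: block_def)
  show ?thesis
  proof (cases "e = 1 \<and> even n")
    case True
    then obtain q where q: "n = 2 * q" "2 \<le> q" using assms(1) by (auto elim!: evenE)
    then have "(n - 1) div 2 = q - 1" by linarith
    then have new: "n - 2 \<in> ?I" using True q by (auto simp: block_def)
    have "even (n - 2)" using True by simp
    moreover have "odd x" if "x \<in> ?O" for x using that by auto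
    ultimately have "n - 2 \<notin> ?O" by blast
    then have "card (insert (n - 2) ?O) = Suc (card ?O)" by simp
    moreover have "card (insert (n - 2) ?O) \<le> card ?I"
      using fin by (rule card_mono) (use new O in blast)
    ultimately have "Suc (card ?O) \<le> card ?I" by (rule subst)
    with True \<open>card ?O = (n - 1) div 2\<close> show ?thesis by simp
  next
    case False
    with card_mono[OF fin O] \<open>card ?O = (n - 1) div 2\<close> show ?thesis by auto
  qed
qed

theorem theorem2p2:
  fixes k n \<epsilon> \<epsilon>' :: nat
  assumes "k \<in> {8, 9}"
    and "\<epsilon> = k mod 2"
    and "n \<ge> k"
    and "\<epsilon>' = (n + 1 + \<epsilon>) mod 2"
  shows "real (planar_anti_ramsey n (path_graph k))
           \<ge> (3 * real n + 3 * real \<epsilon> - real \<epsilon>' - 3) / 2"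
proof -
  define m where "m = n - 2"
  \<comment> \<open>The \<open>n - 1\<close> indices other than 0 are paired up. For
    \<open>k = 9\<close> and even \<open>n\<close> one is left over and contributes an extra colour
    inside the last block.\<close>
  define d :: nat where "d = (if \<epsilon> = 1 \<and> even n then 1 else 0)"
  \<comment> \<open>Index of the last block. For \<open>\<epsilon> = 0\<close> a leftover vertex is
    block \<open>M\<close> by itself; for \<open>\<epsilon> = 1\<close> rounding down makes it join
    the last pair.\<close>
  define M where "M = (n - \<epsilon>) div 2"
  have k: "k = 8 + \<epsilon>" "\<epsilon> \<le> 1" using assms(1,2) by auto
  then have m: "n = m + 2" "6 \<le> m" using assms(3) by (auto simp: m_def)
  have M: "2 \<le> M" "m + 2 \<le> 2 * M + 1 + \<epsilon>" using k m unfolding M_def by linarith+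
  have "n + ((n - 1) div 2 + d)
      \<le> n + card {i. 1 \<le> i \<and> Suc i < n \<and> block M i = block M (Suc i)}"
    unfolding M_def d_def using k m by (intro add_left_mono card_constant_block_edges) auto
  also have "\<dots> \<le> card (fan_colour m M ` edges (double_fan m))"
    using card_fan_colours[of M m] M m by simp
  also have "\<dots> \<le> planar_anti_ramsey n (path_graph k)"
    using double_fan_in_triangulations[of m k] no_rainbow_path[of M m \<epsilon> k] M m k assms(3)
    by (intro card_colours_le_planar_anti_ramsey) auto
  finally have le: "n + ((n - 1) div 2 + d)
      \<le> planar_anti_ramsey n (path_graph k)" .
  \<comment> \<open>For \<open>\<epsilon> = 1\<close> this is an equality. For
    \<open>\<epsilon> = 0\<close> the right side is larger by 2, so the colouring has one colour
    more than claimed.\<close>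
  have "3 * n + 3 * \<epsilon>
      \<le> 2 * (n + ((n - 1) div 2 + d)) + \<epsilon>' + 3"
  proof (cases "even n")
    case True
    then obtain q where q: "n = 2 * q" ..
    then have "(n - 1) div 2 = q - 1" by linarith
    with k m q assms(4) show ?thesis by (auto simp: d_def le_Suc_eq)
  next
    case False
    then obtain q where q: "n = 2 * q + 1" by (auto elim: oddE)
    then have "\<epsilon>' = \<epsilon>" using k assms(4) by presburger
    with q k show ?thesis by simp
  qed
  also have "\<dots> \<le> 2 * planar_anti_ramsey n (path_graph k) + \<epsilon>' + 3"
    by (intro add_right_mono mult_le_mono2 le)
  finally have "3 * n + 3 * \<epsilon> \<le> 2 * planar_anti_ramsey n (path_graph k) + \<epsilon>' + 3" .
  then have "real (3 * n + 3 * \<epsilon>) \<le> real (2 * planar_anti_ramsey n (path_graph k) + \<epsilon>' + 3)"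
    by (simp only: of_nat_le_iff)
  then show ?thesis by simp
qed

end
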